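(* Let $A$ be a complex matrix of rank at least $2$, and let $\overline{A}$ be the matrix of the same size all of whose entries equal the arithmetic mean of the entries of $A$. Let $K:=2\sqrt{\|A\|_1\|A\|_\infty}/\sigma_2(A)$. Then $$\|A-\overline{A}\|_{\Delta}\ge\frac{\sigma_2(A)}{8\sqrt2\sqrt{\log K+2}}.$$
   Context: $\sigma_2(A)$ is the second largest singular value of $A$. $\|A\|_1$ is the largest absolute column sum and $\|A\|_\infty$ the largest absolute row sum of $A$. For a complex matrix $B$ with $n$ columns, $\|B\|_{\Delta}:=\max_{0\ne\xi\in\{0,1\}^n}\|B\xi\|/\|\xi\|$ with $\|\cdot\|$ the Euclidean norm. $\log$ is the natural logarithm. *)

theory Defs
  imports
    "HOL-Analysis.L2_Norm"
    "Jordan_Normal_Form.Schur_Decomposition"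
    "Jordan_Normal_Form.DL_Rank"
begin

definition euclid_norm :: "complex vec \<Rightarrow> real" where
  "euclid_norm v = L2_set (\<lambda>i. cmod (v $ i)) {..<dim_vec v}"

text \<open>
  The matrix \<open>mat_adjoint A * A\<close> is positive semidefinite, so its eigenvalues are real and
  nonnegative and \<open>Re\<close> loses nothing; \<open>proots\<close> counts them with multiplicity.
  The list is decreasing and has one entry per column of \<open>A\<close>: compared with the
  convention of \<open>min (dim_row A) (dim_col A)\<close> singular values, the list is only padded by
  zeros at the end.
\<close>

definition singular_values :: "complex mat \<Rightarrow> real list" where
  "singular_values A =
     rev (sorted_list_of_multiset
       (image_mset (\<lambda>e. sqrt (Re e)) (proots (char_poly (mat_adjoint A * A)))))"

text \<open>The index is 1-based: \<open>sigma 2 A\<close> is the second largest singular value, and it equals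
  \<open>sigma 1 A\<close> if the largest one is repeated.\<close>

definition sigma :: "nat \<Rightarrow> complex mat \<Rightarrow> real" where
  "sigma k A = singular_values A ! (k - 1)"

definition mat_norm_1 :: "complex mat \<Rightarrow> real" where
  "mat_norm_1 A = Max ((\<lambda>j. \<Sum>i<dim_row A. cmod (A $$ (i, j))) ` {..<dim_col A})"

definition mat_norm_inf :: "complex mat \<Rightarrow> real" where
  "mat_norm_inf A = Max ((\<lambda>i. \<Sum>j<dim_col A. cmod (A $$ (i, j))) ` {..<dim_row A})"

definition binary_vecs :: "nat \<Rightarrow> complex vec set" where
  "binary_vecs n = {\<xi> \<in> carrier_vec n. \<forall>i<n. \<xi> $ i \<in> {0, 1}}"

definition delta_norm :: "complex mat \<Rightarrow> real" where
  "delta_norm B =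
     Max ((\<lambda>\<xi>. euclid_norm (B *\<^sub>v \<xi>) / euclid_norm \<xi>)
       ` (binary_vecs (dim_col B) - {0\<^sub>v (dim_col B)}))"

definition mean_mat :: "complex mat \<Rightarrow> complex mat" where
  "mean_mat A = mat (dim_row A) (dim_col A)
     (\<lambda>_. (\<Sum>i<dim_row A. \<Sum>j<dim_col A. A $$ (i, j)) / of_nat (dim_row A * dim_col A))"

end

theory Submission
  imports "HOL-Analysis.Henstock_Kurzweil_Integration" "HOL-Analysis.Harmonic_Numbers" Defs
begin

text \<open>
  Since \<open>A\<close> and \<open>B = A - mean_mat A\<close> agree on vectors with coordinate sum \<open>0\<close>, the
  Courant--Fischer principle gives unit vectors \<open>x\<close> and \<open>y\<close> with \<open>\<langle>y, B x\<rangle> \<ge> s\<close>, where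
  \<open>s\<close> is the second singular value of \<open>A\<close>.
  Split \<open>x\<close> into four nonnegative vectors, up to a phase, and write each of them as the integral
  over \<open>h > 0\<close> of the indicator vectors of \<open>{j. x j \<ge> h}\<close>. For a given \<open>h\<close>, the coordinates
  of \<open>y\<close> with \<open>|y i| < \<alpha> h\<close> or \<open>|y i| > \<beta> h\<close> contribute little because of the bounds on the
  column and row sums of \<open>B\<close>. The others are controlled by the norm of \<open>B\<close> on binary vectors and
  the Cauchy--Schwarz inequality with weight \<open>dh / h\<close>. Each coordinate of \<open>y\<close> is used on an
  interval of logarithmic length \<open>ln (\<beta> / \<alpha>)\<close>, which produces the logarithm in the estimate.
\<close>

section \<open>Bounds for bilinear forms by level sets\<close>

text \<open>Here \<open>s\<close> is the height of the layer, \<open>S\<close> the level set at that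
  height, and \<open>z\<close> the conjugate of the left vector. Rows with small \<open>z i\<close>
  are charged to the column sums, rows with large \<open>z i\<close> to the row sums, and the
  remaining ones go through Cauchy-Schwarz and \<open>bound\<close>. Each resulting term is an
  explicit function of \<open>s\<close>, ready for integration; \<open>\<mu>\<close> is left free to
  balance the middle range.\<close>

lemma layer_bound:
  fixes B :: "'i \<Rightarrow> 'j \<Rightarrow> complex" and z :: "'i \<Rightarrow> complex" and S J :: "'j set"
  assumes fin: "finite I" "finite J" and S: "S \<subseteq> J" and D: "D \<ge> 0"
    and bound: "L2_set (\<lambda>i. cmod (\<Sum>j\<in>S. B i j)) I \<le> D * sqrt (card S)"
    and col: "\<And>j. j \<in> J \<Longrightarrow> (\<Sum>i\<in>I. cmod (B i j)) \<le> L1"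
    and row: "\<And>i. i \<in> I \<Longrightarrow> (\<Sum>j\<in>J. cmod (B i j)) \<le> Linf"
    and pos: "s > 0" "\<mu> > 0" "\<alpha> > 0"
  shows "Re (\<Sum>i\<in>I. \<Sum>j\<in>S. z i * B i j) \<le>
      D * \<mu> / 2 * (\<Sum>i\<in>I. if \<alpha> * s \<le> cmod (z i) \<and> cmod (z i) \<le> \<beta> * s then (cmod (z i))\<^sup>2 / s else 0)
    + (D / (2 * \<mu>) + \<alpha> * L1) * (s * card S)
    + Linf * (\<Sum>i\<in>I. if \<beta> * s \<le> cmod (z i) then cmod (z i) else 0)"
proof -
  define r where "r = (\<lambda>i. cmod (\<Sum>j\<in>S. B i j))"
  define b where "b = (\<lambda>i. if \<alpha> * s \<le> cmod (z i) \<and> cmod (z i) \<le> \<beta> * s then cmod (z i) else 0)"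
  define t where "t = (\<lambda>i. if \<beta> * s \<le> cmod (z i) then cmod (z i) else 0)"
  have finS: "finite S" using S fin finite_subset by blast
  have r_le: "r i \<le> (\<Sum>j\<in>S. cmod (B i j))" for i
    unfolding r_def by (rule norm_sum)
  have r_le': "r i \<le> Linf" if "i \<in> I" for i
    using r_le[of i] row[OF that] sum_mono2[OF fin(2) S, of "\<lambda>j. cmod (B i j)"] by simp
  have term_le: "Re (\<Sum>j\<in>S. z i * B i j) \<le> b i * r i + \<alpha> * s * (\<Sum>j\<in>S. cmod (B i j)) + Linf * t i"
    if i: "i \<in> I" for i
  proof -
    have "Re (\<Sum>j\<in>S. z i * B i j) \<le> cmod (z i * (\<Sum>j\<in>S. B i j))"
      unfolding sum_distrib_left[symmetric] by (rule complex_Re_le_cmod)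
    also have "\<dots> = cmod (z i) * r i" unfolding r_def by (rule norm_mult)
    also have "\<dots> \<le> b i * r i + \<alpha> * s * (\<Sum>j\<in>S. cmod (B i j)) + Linf * t i"
    proof -
      have r0: "r i \<ge> 0" unfolding r_def by simp
      have L0: "Linf \<ge> 0" using r0 r_le'[OF i] by linarith
      have t0: "t i \<ge> 0" and b0: "b i \<ge> 0" unfolding t_def b_def by auto
      have s0: "\<alpha> * s * (\<Sum>j\<in>S. cmod (B i j)) \<ge> 0" using pos by (intro mult_nonneg_nonneg sum_nonneg) auto
      have b1: "b i * r i \<ge> 0" and t1: "Linf * t i \<ge> 0" using r0 L0 t0 b0 by auto
      \<comment> \<open>The cases overlap at the end points, which is harmless: all three terms on
        the right are nonnegative, so in each case one of them suffices and the other two are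
        dropped.\<close>
      consider "cmod (z i) \<le> \<alpha> * s" | "b i = cmod (z i)" | "t i = cmod (z i)"
        unfolding b_def t_def by (metis nle_le)
      then show ?thesis
      proof cases
        case 1
        have "cmod (z i) * r i \<le> \<alpha> * s * (\<Sum>j\<in>S. cmod (B i j))"
          using 1 r_le[of i] r0 pos by (intro mult_mono) auto
        then show ?thesis using b1 t1 by linarith
      next
        case 2
        then show ?thesis using s0 t1 by simp
      next
        case 3
        have "cmod (z i) * r i \<le> Linf * t i"
          using mult_left_mono[OF r_le'[OF i], of "cmod (z i)"] 3 by (simp add: mult.commute)
        then show ?thesis using b1 s0 by linarith
      qed
    qed
    finally show ?thesis .
  qed
  have "(\<Sum>i\<in>I. b i * r i) \<le> (\<Sum>i\<in>I. \<bar>b i\<bar> * \<bar>r i\<bar>)"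
    by (intro sum_mono) (simp flip: abs_mult)
  also have "\<dots> \<le> L2_set b I * L2_set r I" by (rule L2_set_mult_ineq)
  also have "\<dots> \<le> L2_set b I * (D * sqrt (card S))"
    using bound by (intro mult_left_mono) (auto simp: r_def)
  also have "\<dots> = D * (L2_set b I * sqrt (card S))" by simp
  \<comment> \<open>Weighted AM-GM, from the square of \<open>\<mu> * u - s * v\<close>. The weight
    \<open>\<mu> / s\<close> produces the factor \<open>1 / s\<close> that later integrates to a
    logarithm, and leaves \<open>s * card S\<close>, which integrates to squares of the
    \<open>x j\<close>.\<close>
  also have "\<dots> \<le> D * (\<mu> / (2 * s) * (\<Sum>i\<in>I. (b i)\<^sup>2) + s / (2 * \<mu>) * card S)"
  proof (rule mult_left_mono[OF _ D])
    define u where "u = L2_set b I"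
    define v where "v = sqrt (card S)"
    have u2: "(\<Sum>i\<in>I. (b i)\<^sup>2) = u\<^sup>2" unfolding u_def L2_set_def by (simp add: sum_nonneg)
    have v2: "card S = v\<^sup>2" unfolding v_def by simp
    have "0 \<le> (\<mu> * u - s * v)\<^sup>2 / (2 * \<mu> * s)" using pos by simp
    also have "\<dots> = \<mu> / (2 * s) * u\<^sup>2 + s / (2 * \<mu>) * v\<^sup>2 - u * v"
      using pos by (simp add: field_simps power2_eq_square)
    finally show "L2_set b I * sqrt (card S) \<le> \<mu> / (2 * s) * (\<Sum>i\<in>I. (b i)\<^sup>2) + s / (2 * \<mu>) * card S"
      unfolding u2 v2 unfolding u_def v_def by simp
  qed
  finally have main: "(\<Sum>i\<in>I. b i * r i) \<le> \<dots>" .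
  have "(\<Sum>i\<in>I. \<Sum>j\<in>S. cmod (B i j)) = (\<Sum>j\<in>S. \<Sum>i\<in>I. cmod (B i j))" by (rule sum.swap)
  also have "\<dots> \<le> (\<Sum>j\<in>S. L1)" using S by (intro sum_mono col) auto
  finally have tail: "\<alpha> * s * (\<Sum>i\<in>I. \<Sum>j\<in>S. cmod (B i j)) \<le> \<alpha> * s * (L1 * card S)"
    using pos by (intro mult_left_mono) (auto simp: mult.commute)
  have "Re (\<Sum>i\<in>I. \<Sum>j\<in>S. z i * B i j) = (\<Sum>i\<in>I. Re (\<Sum>j\<in>S. z i * B i j))" by simp
  also have "\<dots> \<le> (\<Sum>i\<in>I. b i * r i + \<alpha> * s * (\<Sum>j\<in>S. cmod (B i j)) + Linf * t i)"
    by (intro sum_mono term_le)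
  also have "\<dots> = (\<Sum>i\<in>I. b i * r i) + \<alpha> * s * (\<Sum>i\<in>I. \<Sum>j\<in>S. cmod (B i j)) + Linf * (\<Sum>i\<in>I. t i)"
    by (simp add: sum.distrib sum_distrib_left)
  also have "\<dots> \<le> D * (\<mu> / (2 * s) * (\<Sum>i\<in>I. (b i)\<^sup>2) + s / (2 * \<mu>) * card S)
       + \<alpha> * s * (L1 * card S) + Linf * (\<Sum>i\<in>I. t i)"
    using main tail by linarith
  also have "\<mu> / (2 * s) * (\<Sum>i\<in>I. (b i)\<^sup>2) = \<mu> / 2 * (\<Sum>i\<in>I. if \<alpha> * s \<le> cmod (z i) \<and> cmod (z i) \<le> \<beta> * s then (cmod (z i))\<^sup>2 / s else 0)"
    unfolding sum_distrib_left by (intro sum.cong) (auto simp: b_def)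
  finally show ?thesis unfolding t_def by (simp add: algebra_simps)
qed

text \<open>Integration of \<open>layer_bound\<close> over all heights. The middle range of row
  \<open>i\<close> is an interval with end ratio \<open>\<beta> / \<alpha>\<close>, whence the
  logarithm; the range of large \<open>z i\<close> has length \<open>cmod (z i) / \<beta>\<close>;
  and integrating \<open>s\<close> up to \<open>x j\<close> gives half of its square.\<close>

lemma nonneg_bilinear_bound:
  fixes B :: "'i \<Rightarrow> 'j \<Rightarrow> complex" and z :: "'i \<Rightarrow> complex" and x :: "'j \<Rightarrow> real"
  assumes fin: "finite I" "finite J" and D: "D \<ge> 0"
    and bound: "\<And>S. S \<subseteq> J \<Longrightarrow> L2_set (\<lambda>i. cmod (\<Sum>j\<in>S. B i j)) I \<le> D * sqrt (card S)"
    and col: "\<And>j. j \<in> J \<Longrightarrow> (\<Sum>i\<in>I. cmod (B i j)) \<le> L1"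
    and row: "\<And>i. i \<in> I \<Longrightarrow> (\<Sum>j\<in>J. cmod (B i j)) \<le> Linf"
    and x: "\<And>j. j \<in> J \<Longrightarrow> x j \<ge> 0"
    and pos: "\<mu> > 0" "\<alpha> > 0" "\<alpha> \<le> \<beta>"
  shows "Re (\<Sum>i\<in>I. \<Sum>j\<in>J. z i * B i j * x j) \<le>
      (D * \<mu> / 2 * ln (\<beta> / \<alpha>) + Linf / \<beta>) * (\<Sum>i\<in>I. (cmod (z i))\<^sup>2)
    + (D / (4 * \<mu>) + \<alpha> * L1 / 2) * (\<Sum>j\<in>J. (x j)\<^sup>2)"
proof -
  have beta: "\<beta> > 0" using pos by linarith
  \<comment> \<open>A common upper bound for all interval ends, so that every integral can be taken
    over \<open>{0..R}\<close>. Sums instead of maxima also cover empty \<open>I\<close> or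
    \<open>J\<close>.\<close>
  define R where "R = (\<Sum>j\<in>J. x j) + (\<Sum>i\<in>I. cmod (z i) / \<alpha>)"
  have xR: "x j \<le> R" if "j \<in> J" for j
    using member_le_sum[OF that, of x] x fin pos sum_nonneg[of I "\<lambda>i. cmod (z i) / \<alpha>"]
    unfolding R_def by fastforce
  have zR: "cmod (z i) / \<alpha> \<le> R" if "i \<in> I" for i
    using member_le_sum[OF that, of "\<lambda>i. cmod (z i) / \<alpha>"] x fin pos sum_nonneg[of J x]
    unfolding R_def by fastforce
  have zR': "cmod (z i) / \<beta> \<le> R" if "i \<in> I" for i
    using zR[OF that] frac_le[OF norm_ge_zero order.refl pos(2) pos(3), of "z i"] by linarith
  define f where "f = (\<lambda>s. \<Sum>i\<in>I. \<Sum>j\<in>J. if s \<in> {0..x j} then Re (z i * B i j) else 0)"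
  define g where "g = (\<lambda>s. D * \<mu> / 2 * (\<Sum>i\<in>I. if s \<in> {cmod (z i) / \<beta>..cmod (z i) / \<alpha>} then (cmod (z i))\<^sup>2 / s else 0)
    + (D / (2 * \<mu>) + \<alpha> * L1) * (\<Sum>j\<in>J. if s \<in> {0..x j} then s else 0)
    + Linf * (\<Sum>i\<in>I. if s \<in> {0..cmod (z i) / \<beta>} then cmod (z i) else 0))"
  have int_f: "(f has_integral (\<Sum>i\<in>I. \<Sum>j\<in>J. Re (z i * B i j) * x j)) {0..R}"
    unfolding f_def
  proof (intro has_integral_sum fin)
    fix i j assume "j \<in> J"
    have "((\<lambda>s. Re (z i * B i j)) has_integral Re (z i * B i j) * x j) {0..x j}"
      using has_integral_const_real[of "Re (z i * B i j)" 0 "x j"] x[OF \<open>j \<in> J\<close>] by (simp add: mult.commute)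
    then show "((\<lambda>s. if s \<in> {0..x j} then Re (z i * B i j) else 0) has_integral Re (z i * B i j) * x j) {0..R}"
      using xR[OF \<open>j \<in> J\<close>] by (subst has_integral_restrict) auto
  qed
  have int_log: "((\<lambda>s. if s \<in> {cmod (z i) / \<beta>..cmod (z i) / \<alpha>} then (cmod (z i))\<^sup>2 / s else 0)
      has_integral (cmod (z i))\<^sup>2 * ln (\<beta> / \<alpha>)) {0..R}" if i: "i \<in> I" for i
  proof -
    let ?a = "cmod (z i) / \<beta>" and ?b = "cmod (z i) / \<alpha>"
    have ab: "?a \<le> ?b" using pos by (intro frac_le) auto
    have "((\<lambda>s. (cmod (z i))\<^sup>2 / s) has_integral (cmod (z i))\<^sup>2 * ln (\<beta> / \<alpha>)) {?a..?b}"
    \<comment> \<open>For \<open>z i = 0\<close> the interval is the point 0 and the integral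
      vanishes; otherwise the lower end is positive and \<open>ln\<close> is an antiderivative on
      the interval.\<close>
    proof (cases "z i = 0")
      case False
      have "((\<lambda>s. (cmod (z i))\<^sup>2 * (1 / s)) has_integral (cmod (z i))\<^sup>2 * (ln ?b - ln ?a)) {?a..?b}"
      proof (intro has_integral_mult_right fundamental_theorem_of_calculus ab)
        fix s assume "s \<in> {?a..?b}"
        moreover have "?a > 0" using False beta by simp
        ultimately have "s > 0" by (auto intro: less_le_trans)
        then show "(ln has_vector_derivative 1 / s) (at s within {?a..?b})"
          unfolding has_real_derivative_iff_has_vector_derivative[symmetric]
          by (auto intro!: derivative_eq_intros)
      qed
      then show ?thesis using False pos beta by (simp add: ln_div)
    qed simp
    then show ?thesis using zR[OF i] beta by (subst has_integral_restrict) auto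
  qed
  have int_x: "((\<lambda>s. if s \<in> {0..x j} then s else 0) has_integral (x j)\<^sup>2 / 2) {0..R}" if "j \<in> J" for j
    using ident_has_integral[of 0 "x j"] x[OF that] xR[OF that] by (subst has_integral_restrict) auto
  have int_z: "((\<lambda>s. if s \<in> {0..cmod (z i) / \<beta>} then cmod (z i) else 0) has_integral (cmod (z i))\<^sup>2 / \<beta>) {0..R}"
    if "i \<in> I" for i
    using has_integral_const_real[of "cmod (z i)" 0 "cmod (z i) / \<beta>"] zR'[OF that] beta
    by (subst has_integral_restrict) (auto simp: power2_eq_square)
  have int_g: "(g has_integral (D * \<mu> / 2 * (\<Sum>i\<in>I. (cmod (z i))\<^sup>2 * ln (\<beta> / \<alpha>))
      + (D / (2 * \<mu>) + \<alpha> * L1) * (\<Sum>j\<in>J. (x j)\<^sup>2 / 2) + Linf * (\<Sum>i\<in>I. (cmod (z i))\<^sup>2 / \<beta>))) {0..R}"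
    unfolding g_def
    by (intro has_integral_add has_integral_mult_right has_integral_sum fin int_log int_x int_z)
  have le: "f s \<le> g s" if "s > 0" for s
  proof -
    define S where "S = {j \<in> J. s \<le> x j}"
    have S: "S \<subseteq> J" unfolding S_def by auto
    have "f s = (\<Sum>i\<in>I. \<Sum>j\<in>S. Re (z i * B i j))"
      unfolding f_def S_def sum.inter_filter[OF fin(2)] using that by (intro sum.cong) auto
    also have "\<dots> = Re (\<Sum>i\<in>I. \<Sum>j\<in>S. z i * B i j)" by simp
    also have "\<dots> \<le> D * \<mu> / 2 * (\<Sum>i\<in>I. if \<alpha> * s \<le> cmod (z i) \<and> cmod (z i) \<le> \<beta> * s then (cmod (z i))\<^sup>2 / s else 0)
      + (D / (2 * \<mu>) + \<alpha> * L1) * (s * card S)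
      + Linf * (\<Sum>i\<in>I. if \<beta> * s \<le> cmod (z i) then cmod (z i) else 0)"
      by (rule layer_bound[OF fin S D bound[OF S] col row that pos(1,2)])
    also have "(\<Sum>i\<in>I. if \<alpha> * s \<le> cmod (z i) \<and> cmod (z i) \<le> \<beta> * s then (cmod (z i))\<^sup>2 / s else 0)
      = (\<Sum>i\<in>I. if s \<in> {cmod (z i) / \<beta>..cmod (z i) / \<alpha>} then (cmod (z i))\<^sup>2 / s else 0)"
      using pos beta by (intro sum.cong) (auto simp: field_simps)
    also have "(\<Sum>i\<in>I. if \<beta> * s \<le> cmod (z i) then cmod (z i) else 0)
      = (\<Sum>i\<in>I. if s \<in> {0..cmod (z i) / \<beta>} then cmod (z i) else 0)"
      using beta that by (intro sum.cong) (auto simp: field_simps)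
    also have "s * card S = (\<Sum>j\<in>J. if s \<in> {0..x j} then s else 0)"
      unfolding S_def using fin that by (simp flip: sum.inter_filter)
    finally show ?thesis unfolding g_def .
  qed
  \<comment> \<open>The estimate of a layer needs a positive height, hence the change of value at \<open>0\<close>.\<close>
  have "((\<lambda>s. if s = 0 then g s else f s) has_integral (\<Sum>i\<in>I. \<Sum>j\<in>J. Re (z i * B i j) * x j)) {0..R}"
    by (rule has_integral_spike_finite[OF _ _ int_f, of "{0}"]) auto
  from has_integral_le[OF this int_g]
  have "(\<Sum>i\<in>I. \<Sum>j\<in>J. Re (z i * B i j) * x j) \<le> D * \<mu> / 2 * (\<Sum>i\<in>I. (cmod (z i))\<^sup>2 * ln (\<beta> / \<alpha>))
      + (D / (2 * \<mu>) + \<alpha> * L1) * (\<Sum>j\<in>J. (x j)\<^sup>2 / 2) + Linf * (\<Sum>i\<in>I. (cmod (z i))\<^sup>2 / \<beta>)"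
    using le by auto
  moreover have "(\<Sum>i\<in>I. \<Sum>j\<in>J. Re (z i * B i j) * x j) = Re (\<Sum>i\<in>I. \<Sum>j\<in>J. z i * B i j * x j)"
    by simp
  ultimately have "Re (\<Sum>i\<in>I. \<Sum>j\<in>J. z i * B i j * x j) \<le>
      D * \<mu> / 2 * ((\<Sum>i\<in>I. (cmod (z i))\<^sup>2) * ln (\<beta> / \<alpha>))
      + (D / (2 * \<mu>) + \<alpha> * L1) * ((\<Sum>j\<in>J. (x j)\<^sup>2) / 2) + Linf * ((\<Sum>i\<in>I. (cmod (z i))\<^sup>2) / \<beta>)"
    unfolding sum_distrib_right sum_divide_distrib by linarith
  moreover have "D * \<mu> / 2 * (Y * ln (\<beta> / \<alpha>)) + (D / (2 * \<mu>) + \<alpha> * L1) * (X / 2) + Linf * (Y / \<beta>) =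
      (D * \<mu> / 2 * ln (\<beta> / \<alpha>) + Linf / \<beta>) * Y + (D / (4 * \<mu>) + \<alpha> * L1 / 2) * X" for X Y
    by (simp add: algebra_simps)
  ultimately show ?thesis by simp
qed

text \<open>The parameters of \<open>nonneg_bilinear_bound\<close> are chosen such that the two
  truncation errors amount to \<open>s / 2\<close>, which is absorbed on the left. The second claim
  is the Schur test; it makes the logarithm in the first one nonnegative.\<close>

lemma bilinear_form_le_log:
  fixes B :: "'i \<Rightarrow> 'j \<Rightarrow> complex" and z :: "'i \<Rightarrow> complex" and x :: "'j \<Rightarrow> complex"
  assumes fin: "finite I" "finite J" and D: "D \<ge> 0"
    and bound: "\<And>S. S \<subseteq> J \<Longrightarrow> L2_set (\<lambda>i. cmod (\<Sum>j\<in>S. B i j)) I \<le> D * sqrt (card S)"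
    and col: "\<And>j. j \<in> J \<Longrightarrow> (\<Sum>i\<in>I. cmod (B i j)) \<le> L1"
    and row: "\<And>i. i \<in> I \<Longrightarrow> (\<Sum>j\<in>J. cmod (B i j)) \<le> Linf"
    and z: "(\<Sum>i\<in>I. (cmod (z i))\<^sup>2) = 1" and x: "(\<Sum>j\<in>J. (cmod (x j))\<^sup>2) = 1"
    and s: "s > 0" "s \<le> Re (\<Sum>i\<in>I. \<Sum>j\<in>J. z i * B i j * x j)"
  shows "s \<le> 4 * D * sqrt (ln (sqrt (L1 * Linf) / s) + 2)"
    and "L1 * Linf \<ge> s\<^sup>2"
proof -
  \<comment> \<open>Schur test with a free weight: AM-GM on \<open>cmod (z i) * cmod (x j)\<close>,
    then row sums for the part in \<open>z\<close> and column sums for the part in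
    \<open>x\<close>.\<close>
  have schur: "s \<le> (t * Linf + L1 / t) / 2" if t: "t > 0" for t
  proof -
    have "Re (\<Sum>i\<in>I. \<Sum>j\<in>J. z i * B i j * x j) \<le> cmod (\<Sum>i\<in>I. \<Sum>j\<in>J. z i * B i j * x j)"
      by (rule complex_Re_le_cmod)
    also have "\<dots> \<le> (\<Sum>i\<in>I. \<Sum>j\<in>J. cmod (z i * B i j * x j))"
      by (intro order.trans[OF norm_sum] sum_mono norm_sum)
    also have "\<dots> \<le> (\<Sum>i\<in>I. \<Sum>j\<in>J. t / 2 * (cmod (z i))\<^sup>2 * cmod (B i j) + 1 / (2 * t) * (cmod (x j))\<^sup>2 * cmod (B i j))"
    proof (intro sum_mono)
      fix i j
      have "0 \<le> (t * cmod (z i) - cmod (x j))\<^sup>2 / (2 * t)" using t by simp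
      also have "\<dots> = t / 2 * (cmod (z i))\<^sup>2 + 1 / (2 * t) * (cmod (x j))\<^sup>2 - cmod (z i) * cmod (x j)"
        using t by (simp add: field_simps power2_eq_square)
      finally have "cmod (z i) * cmod (x j) * cmod (B i j) \<le> (t / 2 * (cmod (z i))\<^sup>2 + 1 / (2 * t) * (cmod (x j))\<^sup>2) * cmod (B i j)"
        by (intro mult_right_mono) auto
      then show "cmod (z i * B i j * x j) \<le> t / 2 * (cmod (z i))\<^sup>2 * cmod (B i j) + 1 / (2 * t) * (cmod (x j))\<^sup>2 * cmod (B i j)"
        by (simp add: norm_mult algebra_simps)
    qed
    also have "\<dots> = (\<Sum>i\<in>I. t / 2 * (cmod (z i))\<^sup>2 * (\<Sum>j\<in>J. cmod (B i j)))
        + (\<Sum>j\<in>J. 1 / (2 * t) * (cmod (x j))\<^sup>2 * (\<Sum>i\<in>I. cmod (B i j)))"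
      unfolding sum.distrib sum_distrib_left
      by (subst (2) sum.swap) simp
    also have "\<dots> \<le> (\<Sum>i\<in>I. t / 2 * (cmod (z i))\<^sup>2 * Linf) + (\<Sum>j\<in>J. 1 / (2 * t) * (cmod (x j))\<^sup>2 * L1)"
      using t by (intro add_mono sum_mono mult_left_mono row col) auto
    also have "\<dots> = (t * Linf + L1 / t) / 2"
      by (simp add: z x flip: sum_distrib_left sum_distrib_right sum_divide_distrib)
    finally show ?thesis using s by linarith
  qed
  have "I \<noteq> {}" "J \<noteq> {}" using z x by auto
  then have L0: "L1 \<ge> 0" "Linf \<ge> 0" using row col by (meson all_not_in_conv norm_ge_zero order.trans sum_nonneg)+
  \<comment> \<open>If \<open>Linf\<close> vanished, only \<open>L1 / (2 * t)\<close> would remain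
    in \<open>schur\<close>, and \<open>t = (L1 + 1) / s\<close> makes this smaller than
    \<open>s\<close>.\<close>
  have "Linf \<noteq> 0"
  proof
    assume "Linf = 0"
    then have "s \<le> L1 * s / (2 * (L1 + 1))" using schur[of "(L1 + 1) / s"] L0 s(1) by (simp add: mult.commute)
    then have "s * (L1 + 2) \<le> 0" using L0 by (simp add: field_simps)
    moreover have "s * (L1 + 2) > 0" using s L0 by simp
    ultimately show False by linarith
  qed
  then have Linf: "Linf > 0" using L0 by simp
  \<comment> \<open>The weight \<open>t = s / Linf\<close> turns the row term into
    \<open>s / 2\<close>, which is moved to the left.\<close>
  have "s \<le> (s + L1 * Linf / s) / 2" using schur[of "s / Linf"] s Linf by simp
  then have "s \<le> L1 * Linf / s" by simp
  then show ss: "L1 * Linf \<ge> s\<^sup>2" using s by (simp add: field_simps power2_eq_square)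
  moreover have "s\<^sup>2 > 0" using s by simp
  ultimately have L1: "L1 > 0" using Linf by (smt (verit) zero_less_mult_pos2)
  define K where "K = sqrt (L1 * Linf) / s"
  have K2: "K\<^sup>2 = L1 * Linf / s\<^sup>2" unfolding K_def using L0 by (simp add: power_divide)
  have K1: "K \<ge> 1" unfolding K_def using s ss real_le_rsqrt by auto
  define q where "q = sqrt (ln K + 2)"
  have q2: "q\<^sup>2 = ln K + 2" and q: "q > 0" unfolding q_def using ln_ge_zero[OF K1] by auto
  \<comment> \<open>In the final sum \<open>4 * c + d\<close>, this \<open>\<alpha>\<close>
    contributes \<open>s / 4\<close> through \<open>d\<close>, and \<open>\<beta>\<close>
    contributes four times \<open>s / 16\<close> through \<open>c\<close>. The choice of
    \<open>\<mu>\<close> bounds each of the two remaining terms by \<open>D * q\<close>.\<close>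
  define \<alpha> where "\<alpha> = s / (2 * L1)"
  define \<beta> where "\<beta> = 16 * Linf / s"
  define \<mu> where "\<mu> = 1 / (4 * q)"
  have ab: "\<beta> / \<alpha> = 32 * K\<^sup>2" unfolding K2 \<alpha>_def \<beta>_def using s by (simp add: power2_eq_square)
  have pos: "\<mu> > 0" "\<alpha> > 0" unfolding \<mu>_def \<alpha>_def using q s L1 by auto
  have "K\<^sup>2 \<ge> 1" using K1 by simp
  then have "\<beta> / \<alpha> \<ge> 1" unfolding ab by linarith
  then have le: "\<alpha> \<le> \<beta>" using pos by simp
  \<comment> \<open>The estimate \<open>ln 32 \<le> 4\<close> explains the summand 2 under the root:
    \<open>ln (32 * K\<^sup>2)\<close> is at most \<open>4 + 2 * ln K\<close>.\<close>
  have "ln (32::real) = ln (2 ^ 5)" by simp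
  also have "\<dots> = 5 * ln 2" by (subst ln_realpow) auto
  also have "\<dots> \<le> 4" using ln2_le_25_over_36 by simp
  finally have l: "ln (\<beta> / \<alpha>) \<le> 2 * q\<^sup>2"
    unfolding ab q2 using K1 by (simp add: ln_mult ln_realpow)
  define c where "c = D * \<mu> / 2 * ln (\<beta> / \<alpha>) + Linf / \<beta>"
  define d where "d = D / (4 * \<mu>) + \<alpha> * L1 / 2"
  \<comment> \<open>The phase \<open>w\<close> is absorbed into \<open>z\<close>. Each of the four
    nonnegative pieces of \<open>x\<close> meets all of \<open>z\<close>, but only its share of the
    squared norm of \<open>x\<close>; hence \<open>c\<close> is counted four times and
    \<open>d\<close> once.\<close>
  have part: "Re (\<Sum>i\<in>I. \<Sum>j\<in>J. w * z i * B i j * y j) \<le> c + d * (\<Sum>j\<in>J. (y j)\<^sup>2)"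
    if "cmod w = 1" "\<And>j. y j \<ge> 0" for w y
    using nonneg_bilinear_bound[OF fin D bound col row that(2) pos le, of "\<lambda>i. w * z i"]
    unfolding c_def d_def by (simp add: norm_mult that(1) z)
  define a1 where "a1 = (\<lambda>j. max 0 (Re (x j)))"
  define a2 where "a2 = (\<lambda>j. max 0 (- Re (x j)))"
  define a3 where "a3 = (\<lambda>j. max 0 (Im (x j)))"
  define a4 where "a4 = (\<lambda>j. max 0 (- Im (x j)))"
  have xj: "x j = a1 j + (- 1) * a2 j + \<i> * a3 j + (- \<i>) * a4 j" for j
    unfolding a1_def a2_def a3_def a4_def by (auto simp: complex_eq_iff)
  have xj2: "(cmod (x j))\<^sup>2 = (a1 j)\<^sup>2 + (a2 j)\<^sup>2 + (a3 j)\<^sup>2 + (a4 j)\<^sup>2" for j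
    unfolding cmod_power2 a1_def a2_def a3_def a4_def by (auto simp: max_def)
  have "(\<Sum>i\<in>I. \<Sum>j\<in>J. z i * B i j * x j) =
      (\<Sum>i\<in>I. \<Sum>j\<in>J. 1 * z i * B i j * a1 j) + (\<Sum>i\<in>I. \<Sum>j\<in>J. (- 1) * z i * B i j * a2 j)
    + (\<Sum>i\<in>I. \<Sum>j\<in>J. \<i> * z i * B i j * a3 j) + (\<Sum>i\<in>I. \<Sum>j\<in>J. (- \<i>) * z i * B i j * a4 j)"
    by (subst xj) (simp add: algebra_simps sum.distrib sum_negf sum_subtractf)
  then have "Re (\<Sum>i\<in>I. \<Sum>j\<in>J. z i * B i j * x j) =
      Re (\<Sum>i\<in>I. \<Sum>j\<in>J. 1 * z i * B i j * a1 j) + Re (\<Sum>i\<in>I. \<Sum>j\<in>J. (- 1) * z i * B i j * a2 j)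
    + Re (\<Sum>i\<in>I. \<Sum>j\<in>J. \<i> * z i * B i j * a3 j) + Re (\<Sum>i\<in>I. \<Sum>j\<in>J. (- \<i>) * z i * B i j * a4 j)"
    by (simp only: plus_complex.sel)
  also have "\<dots> \<le> (c + d * (\<Sum>j\<in>J. (a1 j)\<^sup>2)) + (c + d * (\<Sum>j\<in>J. (a2 j)\<^sup>2))
    + (c + d * (\<Sum>j\<in>J. (a3 j)\<^sup>2)) + (c + d * (\<Sum>j\<in>J. (a4 j)\<^sup>2))"
    by (intro add_mono part) (auto simp: a1_def a2_def a3_def a4_def)
  also have "\<dots> = 4 * c + d * (\<Sum>j\<in>J. (a1 j)\<^sup>2 + (a2 j)\<^sup>2 + (a3 j)\<^sup>2 + (a4 j)\<^sup>2)"
    by (simp add: sum.distrib algebra_simps)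
  also have "\<dots> = 4 * c + d" unfolding xj2[symmetric] x by simp
  also have "4 * c + d = D / (2 * q) * ln (\<beta> / \<alpha>) + D * q + s / 2"
    unfolding c_def d_def \<mu>_def using s L1 Linf by (simp add: \<alpha>_def \<beta>_def)
  also have "\<dots> \<le> D / (2 * q) * (2 * q\<^sup>2) + D * q + s / 2"
    using l D q by (intro add_right_mono mult_left_mono) auto
  also have "\<dots> = 2 * D * q + s / 2" using q by (simp add: power2_eq_square)
  finally have "s \<le> 4 * D * q" using s by linarith
  then show "s \<le> 4 * D * sqrt (ln (sqrt (L1 * Linf) / s) + 2)" unfolding q_def K_def .
qed

section \<open>The Gram matrix and the Courant-Fischer argument\<close>

text \<open>The standard Hermitian inner product, linear in the first argument. Vectors are
  functions on indices, so that linear combinations are plain lambda terms.\<close>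

definition cip :: "nat \<Rightarrow> (nat \<Rightarrow> complex) \<Rightarrow> (nat \<Rightarrow> complex) \<Rightarrow> complex" where
  "cip n u v = (\<Sum>i<n. u i * cnj (v i))"

lemma cip_add_left: "cip n (\<lambda>i. a * u i + b * v i) w = a * cip n u w + b * cip n v w"
  unfolding cip_def by (simp add: algebra_simps sum.distrib sum_distrib_left)

lemma cip_commute: "cip n u v = cnj (cip n v u)"
  unfolding cip_def by (simp add: mult.commute)

lemma cip_self: "cip n u u = of_real (\<Sum>i<n. (cmod (u i))\<^sup>2)"
  unfolding cip_def by (simp add: complex_norm_square del: of_real_power)

lemma cip_add_right: "cip n w (\<lambda>i. a * u i + b * v i) = cnj a * cip n w u + cnj b * cip n w v"
  unfolding cip_def by (simp add: algebra_simps sum.distrib sum_distrib_left)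

lemma mult_mat_index:
  assumes "X \<in> carrier_mat m n" "Y \<in> carrier_mat n k" "i < m" "j < k"
  shows "(X * Y) $$ (i, j) = (\<Sum>l<n. X $$ (i, l) * Y $$ (l, j))"
  using assms by (simp add: scalar_prod_def atLeast0LessThan)

lemma mat_adjoint_mult_index:
  assumes A: "A \<in> carrier_mat m n" and "i < n" "j < n"
  shows "(mat_adjoint A * A) $$ (i, j) = (\<Sum>k<m. cnj (A $$ (k, i)) * A $$ (k, j))"
  using assms unfolding mat_adjoint_def
  by (simp add: scalar_prod_def mat_of_rows_def atLeast0LessThan)

lemma gram_carrier:
  assumes "A \<in> carrier_mat m n"
  shows "mat_adjoint A * A \<in> carrier_mat n n"
  using assms unfolding mat_adjoint_def by auto

text \<open>Moves the adjoint to the other side of the inner product, so that the action of the Gram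
  matrix on Schur vectors becomes information on a form that is visibly Hermitian and
  positive.\<close>

lemma gram_form:
  assumes A: "A \<in> carrier_mat m n"
  shows "cip n (\<lambda>i. \<Sum>j<n. (mat_adjoint A * A) $$ (i, j) * u j) v
    = cip m (\<lambda>k. \<Sum>j<n. A $$ (k, j) * u j) (\<lambda>k. \<Sum>j<n. A $$ (k, j) * v j)"
proof -
  have "cip n (\<lambda>i. \<Sum>j<n. (mat_adjoint A * A) $$ (i, j) * u j) v
    = (\<Sum>i<n. \<Sum>j<n. \<Sum>k<m. A $$ (k, j) * u j * cnj (A $$ (k, i) * v i))"
    unfolding cip_def
    by (simp add: mat_adjoint_mult_index[OF A] sum_distrib_left sum_distrib_right mult_ac)
  also have "\<dots> = (\<Sum>i<n. \<Sum>k<m. \<Sum>j<n. A $$ (k, j) * u j * cnj (A $$ (k, i) * v i))"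
    by (intro sum.cong refl sum.swap)
  also have "\<dots> = (\<Sum>k<m. \<Sum>i<n. \<Sum>j<n. A $$ (k, j) * u j * cnj (A $$ (k, i) * v i))"
    by (rule sum.swap)
  also have "\<dots> = cip m (\<lambda>k. \<Sum>j<n. A $$ (k, j) * u j) (\<lambda>k. \<Sum>j<n. A $$ (k, j) * v j)"
    unfolding cip_def cnj_sum sum_product by (intro sum.cong refl sum.swap)
  finally show ?thesis .
qed

text \<open>Lists the eigenvalues in the order of the singular values, so that a Schur decomposition
  can be requested with exactly this diagonal.\<close>

lemma singular_values_eq_sqrt_eigenvalues:
  assumes A: "A \<in> carrier_mat m n"
  obtains es where "char_poly (mat_adjoint A * A) = (\<Prod>e\<leftarrow>es. [:- e, 1:])" "length es = n"
    "singular_values A = map (\<lambda>e. sqrt (Re e)) es"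
proof -
  let ?M = "mat_adjoint A * A"
  let ?f = "\<lambda>e. sqrt (Re e)"
  have M: "?M \<in> carrier_mat n n" by (rule gram_carrier[OF A])
  obtain es0 where es0: "mset es0 = proots (char_poly ?M)" by (rule exE[OF ex_mset])
  \<comment> \<open>The eigenvalues are complex numbers here, so they are sorted by the key
    \<open>?f\<close>.\<close>
  define es where "es = rev (sort_key ?f es0)"
  have mes: "mset es = proots (char_poly ?M)" unfolding es_def by (simp add: es0)
  have cp: "char_poly ?M = (\<Prod>e\<leftarrow>es. [:- e, 1:])"
  proof -
    have "(\<Prod>e\<leftarrow>es. [:- e, 1:]) = (\<Prod>e\<in>#proots (char_poly ?M). [:- e, 1:])"
      unfolding mes[symmetric] prod_mset_prod_list[symmetric] by simp
    then show ?thesis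
      using complex_poly_decompose_multiset[of "char_poly ?M"] degree_monic_char_poly[OF M] by simp
  qed
  have len: "length es = n"
    using size_proots_complex[of "char_poly ?M"] degree_monic_char_poly[OF M] mes
    by (metis size_mset)
  have "sort (map ?f es0) = map ?f (sort_key ?f es0)"
    by (rule properties_for_sort) auto
  moreover have "sorted_list_of_multiset (image_mset ?f (mset es0)) = sort (map ?f es0)"
    by (metis mset_map sorted_list_of_multiset_mset)
  ultimately have "singular_values A = map ?f es"
    unfolding singular_values_def es_def es0[symmetric] rev_map[symmetric] by simp
  then show thesis using that cp len by blast
qed

lemma sorted_singular_values: "sorted (rev (singular_values A))"
  unfolding singular_values_def by simp

text \<open>Courant--Fischer: the span of the first two singular vectors meets the hyperplane of vectors
  with coordinate sum \<open>0\<close>.\<close>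

lemma exists_balanced_vector_ge_sigma_2:
  assumes A: "A \<in> carrier_mat m n" and n: "n \<ge> 2"
  obtains x :: "nat \<Rightarrow> complex" where "(\<Sum>j<n. (cmod (x j))\<^sup>2) = 1" "(\<Sum>j<n. x j) = 0"
    "L2_set (\<lambda>i. cmod (\<Sum>j<n. A $$ (i, j) * x j)) {..<m} \<ge> sigma 2 A" "sigma 2 A \<ge> 0"
proof -
  let ?M = "mat_adjoint A * A"
  have M: "?M \<in> carrier_mat n n" by (rule gram_carrier[OF A])
  obtain es where cp: "char_poly ?M = (\<Prod>e\<leftarrow>es. [:- e, 1:])" and len: "length es = n"
    and sv: "singular_values A = map (\<lambda>e. sqrt (Re e)) es"
    using singular_values_eq_sqrt_eigenvalues[OF A] .
  have "sorted_wrt (\<ge>) (singular_values A)"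
    using sorted_singular_values[of A] by (simp add: sorted_wrt_rev)
  then have "singular_values A ! 1 \<le> singular_values A ! 0"
    by (rule sorted_wrt_nth_less) (use n len in \<open>simp_all add: sv\<close>)
  then have "sqrt (Re (es ! 1)) \<le> sqrt (Re (es ! 0))"
    using n len by (simp add: sv)
  \<comment> \<open>\<open>sqrt\<close> is strictly increasing on all reals, negative ones included,
    so this precedes any knowledge of signs.\<close>
  then have e_le: "Re (es ! 1) \<le> Re (es ! 0)" by simp
  have sigma: "sigma 2 A = sqrt (Re (es ! 1))" unfolding sigma_def sv using n len by simp
  obtain T P Q where schur: "schur_decomposition ?M es = (T, P, Q)"
    by (cases "schur_decomposition ?M es") auto
  from schur_decomposition[OF M cp schur]
  have sim: "similar_mat_wit ?M T P Q" and tri: "upper_triangular T" and diag: "diag_mat T = es" by auto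
  note simD = similar_mat_witD2[OF M sim]
  note QP = simD(2) and T = simD(5) and P = simD(6) and Q = simD(7)
  have "?M * P = P * T * Q * P" by (rule arg_cong[OF simD(3), of "\<lambda>X. X * P"])
  also have "\<dots> = P * T * (Q * P)" using P Q T by (intro assoc_mult_mat[of _ n n _ n _ n]) auto
  also have "\<dots> = P * T" unfolding QP using P T by (intro right_mult_one_mat[of _ n n]) auto
  finally have MP: "?M * P = P * T" .
  \<comment> \<open>The first two Schur vectors. As \<open>T\<close> is triangular,
    \<open>p1\<close> is an eigenvector, and \<open>p2\<close> is one up to the multiple
    \<open>t\<close> of \<open>p1\<close>.\<close>
  define p1 where "p1 = (\<lambda>i. P $$ (i, 0))"
  define p2 where "p2 = (\<lambda>i. P $$ (i, 1))"
  define t where "t = T $$ (0, 1)"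
  define e1 where "e1 = es ! 0"
  define e2 where "e2 = es ! 1"
  have Tdiag: "T $$ (0, 0) = e1" "T $$ (1, 1) = e2"
    unfolding e1_def e2_def diag[symmetric] diag_mat_def using T n by auto
  have MP_sum: "(\<Sum>k<n. ?M $$ (i, k) * P $$ (k, j)) = (\<Sum>k<n. P $$ (i, k) * T $$ (k, j))"
    if "i < n" "j < n" for i j
    unfolding mult_mat_index[OF M P that, symmetric] mult_mat_index[OF P T that, symmetric] MP ..
  have Tz: "T $$ (k, j) = 0" if "k < n" "j < k" for k j
    using tri that T unfolding upper_triangular_def by auto
  have M1: "(\<Sum>k<n. ?M $$ (i, k) * p1 k) = e1 * p1 i" if "i < n" for i
  proof -
    have "(\<Sum>k<n. ?M $$ (i, k) * p1 k) = (\<Sum>k<n. P $$ (i, k) * T $$ (k, 0))"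
      unfolding p1_def using MP_sum[of i 0] that n by simp
    also have "\<dots> = (\<Sum>k\<in>{0}. P $$ (i, k) * T $$ (k, 0))"
      using n Tz by (intro sum.mono_neutral_right) auto
    finally show ?thesis by (simp add: Tdiag p1_def)
  qed
  have M2: "(\<Sum>k<n. ?M $$ (i, k) * p2 k) = t * p1 i + e2 * p2 i" if "i < n" for i
  proof -
    have "(\<Sum>k<n. ?M $$ (i, k) * p2 k) = (\<Sum>k<n. P $$ (i, k) * T $$ (k, 1))"
      unfolding p2_def using MP_sum[of i 1] that n by simp
    also have "\<dots> = (\<Sum>k\<in>{0, 1}. P $$ (i, k) * T $$ (k, 1))"
      using n Tz by (intro sum.mono_neutral_right) auto
    finally show ?thesis using Tdiag by (simp add: p1_def p2_def t_def mult.commute)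
  qed
  have QP_sum: "(\<Sum>k<n. Q $$ (i, k) * P $$ (k, j)) = (if i = j then 1 else 0)" if "i < n" "j < n" for i j
    unfolding mult_mat_index[OF Q P that, symmetric] QP using that by simp
  \<comment> \<open>Rows 0 and 1 of the left inverse \<open>Q\<close> read off the
    coefficients.\<close>
  have indep: "a = 0 \<and> b = 0" if "\<And>i. i < n \<Longrightarrow> a * p1 i + b * p2 i = 0" for a b
  proof -
    have *: "a * (\<Sum>k<n. Q $$ (i, k) * p1 k) + b * (\<Sum>k<n. Q $$ (i, k) * p2 k) = 0" for i
    proof -
      have "a * (\<Sum>k<n. Q $$ (i, k) * p1 k) + b * (\<Sum>k<n. Q $$ (i, k) * p2 k)
        = (\<Sum>k<n. Q $$ (i, k) * (a * p1 k + b * p2 k))"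
        by (simp add: algebra_simps sum.distrib sum_distrib_left)
      also have "\<dots> = 0" using that by (intro sum.neutral) simp
      finally show ?thesis .
    qed
    show ?thesis using *[of 0] *[of 1] n by (simp add: p1_def p2_def QP_sum)
  qed
  \<comment> \<open>\<open>F u\<close> is the image of \<open>u\<close> under \<open>A\<close>, and
    \<open>H\<close> is the Hermitian form of the Gram matrix.\<close>
  define F where "F = (\<lambda>u k. \<Sum>j<n. A $$ (k, j) * u j)"
  define H where "H = (\<lambda>u v. cip m (F u) (F v))"
  have F_add: "F (\<lambda>i. a * u i + b * v i) = (\<lambda>k. a * F u k + b * F v k)" for a b u v
    unfolding F_def by (simp add: algebra_simps sum.distrib sum_distrib_left)
  have H_add: "H (\<lambda>i. a * u i + b * v i) w = a * H u w + b * H v w" for a b u v w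
    unfolding H_def F_add by (rule cip_add_left)
  have H_add': "H w (\<lambda>i. a * u i + b * v i) = cnj a * H w u + cnj b * H w v" for a b u v w
    unfolding H_def F_add by (rule cip_add_right)
  have H_comm: "H u v = cnj (H v u)" for u v unfolding H_def by (rule cip_commute)
  have H1: "H p1 v = e1 * cip n p1 v" for v
    unfolding H_def F_def gram_form[OF A, symmetric]
    using M1 by (simp add: cip_def sum_distrib_left mult.assoc)
  have H2: "H p2 v = t * cip n p1 v + e2 * cip n p2 v" for v
    unfolding H_def F_def gram_form[OF A, symmetric] cip_add_left[symmetric]
    using M2 by (simp add: cip_def)
  define N where "N = (\<lambda>u :: nat \<Rightarrow> complex. \<Sum>i<n. (cmod (u i))\<^sup>2)"
  have cipN: "cip n u u = of_real (N u)" for u unfolding N_def by (rule cip_self)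
  have N0: "N u \<ge> 0" for u unfolding N_def by (simp add: sum_nonneg)
  have N_zero: "u i = 0" if "N u = 0" "i < n" for u i
    using that unfolding N_def by (simp add: sum_nonneg_eq_0_iff)
  have Np1: "N p1 \<noteq> 0" using indep[of 1 0] N_zero[of p1] by auto
  \<comment> \<open>Gram-Schmidt: \<open>q\<close> is \<open>p2\<close> made orthogonal to
    \<open>p1\<close>. The factors \<open>1\<close> and \<open>- c\<close> match the shape of
    \<open>cip_add_left\<close> and \<open>H_add\<close>.\<close>
  define c where "c = cip n p2 p1 / cip n p1 p1"
  define q where "q = (\<lambda>i. 1 * p2 i + (- c) * p1 i)"
  have orth: "cip n q p1 = 0"
    unfolding q_def cip_add_left c_def using Np1 by (simp add: cipN)
  have orth': "cip n p1 q = 0" using orth cip_commute[of n p1 q] by simp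
  have Nq: "N q \<noteq> 0"
    using indep[of "- c" 1] N_zero[of q] unfolding q_def by (auto simp: algebra_simps)
  \<comment> \<open>The coefficient of \<open>p1\<close> in the image of \<open>q\<close> under the
    Gram matrix. Hermitian symmetry gives \<open>H q p1 = 0\<close>, which forces it to vanish, so
    \<open>q\<close> acts as an eigenvector for \<open>e2\<close>.\<close>
  define \<tau> where "\<tau> = t - c * e1 + c * e2"
  have Hq: "H q v = \<tau> * cip n p1 v + e2 * cip n q v" for v
    unfolding q_def H_add H1 H2 cip_add_left \<tau>_def by (simp add: algebra_simps)
  have H1q: "H p1 q = 0" unfolding H1 orth' by simp
  then have Hq1: "H q p1 = 0" using H_comm[of q p1] by simp
  then have "\<tau> = 0" using Hq[of p1] orth Np1 by (simp add: cipN)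
  then have Hqq: "H q q = e2 * N q" using Hq[of q] by (simp add: cipN)
  have H_self: "Re (H u u) = (\<Sum>k<m. (cmod (F u k))\<^sup>2)" for u
    unfolding H_def cip_self by simp
  have "Re e2 * N q \<ge> 0" using H_self[of q] unfolding Hqq by (simp add: sum_nonneg)
  then have e2: "Re e2 \<ge> 0" using Nq N0[of q] by (simp add: zero_le_mult_iff)
  define \<sigma>1 where "\<sigma>1 = (\<Sum>j<n. p1 j)"
  define \<sigma>2 where "\<sigma>2 = (\<Sum>j<n. q j)"
  \<comment> \<open>The coordinate sum is one linear functional on a two-dimensional span, so it has
    a nontrivial zero there.\<close>
  obtain a b where ab: "a * \<sigma>1 + b * \<sigma>2 = 0" "a \<noteq> 0 \<or> b \<noteq> 0"
  proof (cases "\<sigma>1 = 0")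
    case True
    then show thesis using that[of 1 0] by simp
  next
    case False
    then show thesis using that[of "- \<sigma>2" \<sigma>1] by simp
  qed
  define w where "w = (\<lambda>i. a * p1 i + b * q i)"
  have w_sum: "(\<Sum>j<n. w j) = 0"
    using ab(1) unfolding w_def \<sigma>1_def \<sigma>2_def by (simp add: sum.distrib sum_distrib_left)
  have aa: "cnj z * z = of_real ((cmod z)\<^sup>2)" for z
    by (metis complex_norm_square mult.commute)
  have "cip n w w = of_real ((cmod a)\<^sup>2 * N p1 + (cmod b)\<^sup>2 * N q)"
    unfolding w_def cip_add_left cip_add_right orth orth' cipN of_real_add of_real_mult aa[symmetric]
    by (simp add: algebra_simps)
  then have Nw: "N w = (cmod a)\<^sup>2 * N p1 + (cmod b)\<^sup>2 * N q"
    unfolding cipN of_real_eq_iff .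
  have "H w w = of_real ((cmod a)\<^sup>2 * N p1) * e1 + of_real ((cmod b)\<^sup>2 * N q) * e2"
    unfolding w_def H_add H_add' H1q Hq1 Hqq H1 orth' cipN of_real_mult aa[symmetric]
    by (simp add: algebra_simps)
  then have "Re (H w w) = (cmod a)\<^sup>2 * N p1 * Re e1 + (cmod b)\<^sup>2 * N q * Re e2"
    by simp
  also have "\<dots> \<ge> (cmod a)\<^sup>2 * N p1 * Re e2 + (cmod b)\<^sup>2 * N q * Re e2"
    using e_le N0[of p1] unfolding e1_def e2_def by (intro add_right_mono mult_left_mono) auto
  finally have Hw: "Re (H w w) \<ge> Re e2 * N w" unfolding Nw by (simp add: algebra_simps)
  have "N w > 0"
    unfolding Nw using ab(2) Np1 Nq N0[of p1] N0[of q]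
    by (smt (verit) mult_nonneg_nonneg mult_pos_pos zero_le_power2 zero_less_power2 norm_eq_zero)
  define r where "r = sqrt (N w)"
  have r: "r > 0" "r\<^sup>2 = N w" unfolding r_def using \<open>N w > 0\<close> by auto
  define x where "x = (\<lambda>j. w j / of_real r)"
  have "(\<Sum>j<n. (cmod (x j))\<^sup>2) = 1"
    unfolding x_def using r \<open>N w > 0\<close>
    by (simp add: norm_divide power_divide flip: sum_divide_distrib N_def[THEN fun_cong])
  moreover have "(\<Sum>j<n. x j) = 0" unfolding x_def using w_sum by (simp flip: sum_divide_distrib)
  moreover have "L2_set (\<lambda>i. cmod (\<Sum>j<n. A $$ (i, j) * x j)) {..<m} \<ge> sigma 2 A"
  proof -
    have "(\<Sum>i<m. (cmod (\<Sum>j<n. A $$ (i, j) * x j))\<^sup>2) = (\<Sum>i<m. (cmod (F w i))\<^sup>2) / N w"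
      unfolding x_def F_def using r
      by (simp add: norm_divide power_divide flip: sum_divide_distrib)
    also have "\<dots> \<ge> Re e2" using Hw \<open>N w > 0\<close> unfolding H_self by (simp add: field_simps)
    finally show ?thesis unfolding L2_set_def sigma e2_def[symmetric] by simp
  qed
  moreover have "sigma 2 A \<ge> 0" unfolding sigma e2_def[symmetric] using e2 by simp
  ultimately show thesis by (rule that)
qed

section \<open>The norm on binary vectors, and row and column sums\<close>

lemma finite_binary_vecs: "finite (binary_vecs n)"
proof (rule finite_subset)
  show "binary_vecs n \<subseteq> vec n ` ({..<n} \<rightarrow>\<^sub>E {0, 1})"
  proof
    fix \<xi> assume \<xi>: "\<xi> \<in> binary_vecs n"
    then have "\<xi> = vec n (restrict (vec_index \<xi>) {..<n})" "restrict (vec_index \<xi>) {..<n} \<in> {..<n} \<rightarrow>\<^sub>E {0, 1}"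
      unfolding binary_vecs_def by auto
    then show "\<xi> \<in> vec n ` ({..<n} \<rightarrow>\<^sub>E {0, 1})" by blast
  qed
  show "finite (vec n ` ({..<n} \<rightarrow>\<^sub>E {0, 1 :: complex}))" by (intro finite_imageI finite_PiE) auto
qed

lemma delta_norm_ge:
  assumes "\<xi> \<in> binary_vecs (dim_col B)" "\<xi> \<noteq> 0\<^sub>v (dim_col B)"
  shows "euclid_norm (B *\<^sub>v \<xi>) / euclid_norm \<xi> \<le> delta_norm B"
  unfolding delta_norm_def using assms finite_binary_vecs by (intro Max_ge) auto

lemma euclid_norm_nonneg: "euclid_norm v \<ge> 0"
  unfolding euclid_norm_def by simp

lemma indicator_vec_binary: "vec n (\<lambda>j. if j \<in> S then 1 else 0) \<in> binary_vecs n"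
  unfolding binary_vecs_def by auto

lemma delta_norm_nonneg:
  assumes "dim_col B > 0"
  shows "delta_norm B \<ge> 0"
proof -
  \<comment> \<open>The first standard basis vector shows that the maximum is over a nonempty
    set.\<close>
  let ?\<xi> = "vec (dim_col B) (\<lambda>j. if j \<in> {0} then 1 else 0) :: complex vec"
  have "?\<xi> $ 0 \<noteq> 0\<^sub>v (dim_col B) $ 0" using assms by simp
  then have "?\<xi> \<noteq> 0\<^sub>v (dim_col B)" by metis
  from delta_norm_ge[OF indicator_vec_binary this] show ?thesis
    by (rule order.trans[rotated]) (intro divide_nonneg_nonneg euclid_norm_nonneg)
qed

text \<open>Supplies the hypothesis \<open>bound\<close> of the estimates above: the vector of sums
  over \<open>S\<close> is the image of the indicator of \<open>S\<close>, which has norm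
  \<open>sqrt (card S)\<close>. For empty \<open>S\<close>, the zero vector excluded from the
  maximum, both sides are 0.\<close>

lemma L2_set_subset_sum_le_delta_norm:
  assumes B: "B \<in> carrier_mat m n" and S: "S \<subseteq> {..<n}"
  shows "L2_set (\<lambda>i. cmod (\<Sum>j\<in>S. B $$ (i, j))) {..<m} \<le> delta_norm B * sqrt (card S)"
proof (cases "S = {}")
  case False
  then obtain k where k: "k \<in> S" by blast
  have fin: "finite S" using S finite_subset by blast
  let ?\<xi> = "vec n (\<lambda>j. if j \<in> S then 1 else 0) :: complex vec"
  have dim: "dim_col B = n" "dim_row B = m" using B by auto
  have "?\<xi> $ k \<noteq> 0\<^sub>v n $ k" using k S by auto
  then have ne: "?\<xi> \<noteq> 0\<^sub>v n" by metis
  have "(\<Sum>j<n. (cmod (?\<xi> $ j))\<^sup>2) = (\<Sum>j<n. if j \<in> S then 1 else 0)"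
    by (intro sum.cong) auto
  also have "\<dots> = card S" using S by (simp add: sum.If_cases Int_absorb1)
  finally have norm: "euclid_norm ?\<xi> = sqrt (card S)"
    unfolding euclid_norm_def L2_set_def by simp
  have "(B *\<^sub>v ?\<xi>) $ i = (\<Sum>j\<in>S. B $$ (i, j))" if "i < m" for i
  proof -
    have "(B *\<^sub>v ?\<xi>) $ i = (\<Sum>j<n. if j \<in> S then B $$ (i, j) else 0)"
      using B that by (auto simp: scalar_prod_def atLeast0LessThan intro!: sum.cong)
    also have "\<dots> = (\<Sum>j\<in>S. B $$ (i, j))" using S by (simp add: sum.If_cases Int_absorb1)
    finally show ?thesis .
  qed
  then have "euclid_norm (B *\<^sub>v ?\<xi>) = L2_set (\<lambda>i. cmod (\<Sum>j\<in>S. B $$ (i, j))) {..<m}"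
    unfolding euclid_norm_def using dim by (intro L2_set_cong) auto
  moreover have "card S > 0" using fin k by (auto simp: card_gt_0_iff)
  ultimately show ?thesis
    using delta_norm_ge[of ?\<xi> B] ne indicator_vec_binary[of n S] unfolding dim norm
    by (simp add: divide_le_eq)
qed (simp add: L2_set_def)

lemma mat_norm_1_ge: "j < dim_col A \<Longrightarrow> (\<Sum>i<dim_row A. cmod (A $$ (i, j))) \<le> mat_norm_1 A"
  unfolding mat_norm_1_def by (intro Max_ge) auto

lemma mat_norm_inf_ge: "i < dim_row A \<Longrightarrow> (\<Sum>j<dim_col A. cmod (A $$ (i, j))) \<le> mat_norm_inf A"
  unfolding mat_norm_inf_def by (intro Max_ge) auto

text \<open>A column of the mean matrix has absolute sum at most the average absolute column sum of
  \<open>A\<close>, hence at most the largest one; likewise for rows. The triangle inequality then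
  gives the factor 2, which is the 2 in \<open>K\<close>.\<close>

lemma minus_mean_sum_le:
  assumes A: "A \<in> carrier_mat m n"
  shows "j < n \<Longrightarrow> (\<Sum>i<m. cmod ((A - mean_mat A) $$ (i, j))) \<le> 2 * mat_norm_1 A"
    and "i < m \<Longrightarrow> (\<Sum>j<n. cmod ((A - mean_mat A) $$ (i, j))) \<le> 2 * mat_norm_inf A"
proof -
  have dim: "dim_col A = n" "dim_row A = m" using A by auto
  define c where "c = (\<Sum>i<m. \<Sum>j<n. A $$ (i, j)) / of_nat (m * n)"
  have entry: "(A - mean_mat A) $$ (i, j) = A $$ (i, j) - c" if "i < m" "j < n" for i j
    using that A unfolding mean_mat_def c_def by simp
  have entry_le: "cmod ((A - mean_mat A) $$ (i, j)) \<le> cmod (A $$ (i, j)) + cmod c" if "i < m" "j < n" for i j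
    unfolding entry[OF that] by (rule norm_triangle_ineq4)
  define s where "s = (\<Sum>i<m. \<Sum>j<n. cmod (A $$ (i, j)))"
  have "cmod (\<Sum>i<m. \<Sum>j<n. A $$ (i, j)) \<le> s"
    unfolding s_def by (intro order.trans[OF norm_sum] sum_mono norm_sum)
  then have c: "cmod c \<le> s / (m * n)"
    unfolding c_def by (simp add: norm_divide norm_mult divide_right_mono)
  have "s \<le> m * mat_norm_inf A"
    unfolding s_def using sum_mono[of "{..<m}" _ "\<lambda>_. mat_norm_inf A"] mat_norm_inf_ge[of _ A] by (simp add: dim)
  have s1: "s \<le> n * mat_norm_1 A"
    unfolding s_def using sum_mono[of "{..<n}" _ "\<lambda>_. mat_norm_1 A"] mat_norm_1_ge[of _ A]
    by (subst sum.swap) (simp add: dim)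
  {
    assume j: "j < n"
    show "(\<Sum>i<m. cmod ((A - mean_mat A) $$ (i, j))) \<le> 2 * mat_norm_1 A"
    proof (cases "m = 0")
      case True
      then show ?thesis using mat_norm_1_ge[of j A] j by (simp add: dim)
    next
      case False
      have "m * cmod c \<le> m * (s / (m * n))" using c by (intro mult_left_mono) auto
      also have "\<dots> = s / n" using False by simp
      also have "\<dots> \<le> mat_norm_1 A" using s1 j by (simp add: divide_le_eq mult.commute)
      finally have mc: "m * cmod c \<le> mat_norm_1 A" .
      have "(\<Sum>i<m. cmod ((A - mean_mat A) $$ (i, j))) \<le> (\<Sum>i<m. cmod (A $$ (i, j)) + cmod c)"
        using j by (intro sum_mono entry_le) auto
      then show ?thesis using mc mat_norm_1_ge[of j A] j by (simp add: dim sum.distrib)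
    qed
  next
    assume i: "i < m"
    show "(\<Sum>j<n. cmod ((A - mean_mat A) $$ (i, j))) \<le> 2 * mat_norm_inf A"
    proof (cases "n = 0")
      case True
      then show ?thesis using mat_norm_inf_ge[of i A] i by (simp add: dim)
    next
      case False
      have "n * cmod c \<le> n * (s / (m * n))" using c by (intro mult_left_mono) auto
      also have "\<dots> = s / m" using False by simp
      also have "\<dots> \<le> mat_norm_inf A" using \<open>s \<le> m * mat_norm_inf A\<close> i by (simp add: divide_le_eq mult.commute)
      finally have nc: "n * cmod c \<le> mat_norm_inf A" .
      have "(\<Sum>j<n. cmod ((A - mean_mat A) $$ (i, j))) \<le> (\<Sum>j<n. cmod (A $$ (i, j)) + cmod c)"
        using i by (intro sum_mono entry_le) auto
      then show ?thesis using nc mat_norm_inf_ge[of i A] i by (simp add: dim sum.distrib)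
    qed
  }
qed

theorem theorem3:
  fixes A :: "complex mat" and m n :: nat and K :: real
  assumes "A \<in> carrier_mat m n"
    and "vec_space.rank m A \<ge> 2"
    and "K = 2 * sqrt (mat_norm_1 A * mat_norm_inf A) / sigma 2 A"
  shows "delta_norm (A - mean_mat A) \<ge> sigma 2 A / (8 * sqrt 2 * sqrt (ln K + 2))"
proof -
  note A = assms(1)
  let ?B = "A - mean_mat A"
  have B: "?B \<in> carrier_mat m n" using A unfolding mean_mat_def by auto
  interpret vec_space "TYPE(complex)" m .
  have n: "n \<ge> 2" using rank_le_nc[OF A] assms(2) by linarith
  have D: "delta_norm ?B \<ge> 0" using B n by (intro delta_norm_nonneg) auto
  define s where "s = sigma 2 A"
  obtain x :: "nat \<Rightarrow> complex" where x: "(\<Sum>j<n. (cmod (x j))\<^sup>2) = 1" and x_sum: "(\<Sum>j<n. x j) = 0"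
    and Ax: "L2_set (\<lambda>i. cmod (\<Sum>j<n. A $$ (i, j) * x j)) {..<m} \<ge> s" and s0: "s \<ge> 0"
    using exists_balanced_vector_ge_sigma_2[OF A n] unfolding s_def .
  show ?thesis
  \<comment> \<open>For \<open>s = 0\<close> the claim is nonnegativity of
    \<open>delta_norm\<close>; the main argument divides by \<open>s\<close>.\<close>
  proof (cases "s = 0")
    case True
    then show ?thesis using D unfolding s_def by simp
  next
    case False
    then have s: "s > 0" using s0 by simp
    define y where "y = (\<lambda>i. \<Sum>j<n. A $$ (i, j) * x j)"
    define r where "r = L2_set (\<lambda>i. cmod (y i)) {..<m}"
    have r: "r \<ge> s" "r > 0" unfolding r_def y_def using Ax s by auto
    have r2: "(\<Sum>i<m. (cmod (y i))\<^sup>2) = r\<^sup>2"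
      unfolding r_def L2_set_def by (simp add: sum_nonneg)
    \<comment> \<open>The normalized conjugate of the image of \<open>x\<close>, for which the
      bilinear form takes the value \<open>r\<close>, the norm of that image.\<close>
    define z where "z = (\<lambda>i. cnj (y i) / of_real r)"
    have z: "(\<Sum>i<m. (cmod (z i))\<^sup>2) = 1"
      unfolding z_def using r r2 by (simp add: norm_divide power_divide flip: sum_divide_distrib)
    \<comment> \<open>The mean matrix annihilates \<open>x\<close>, whose coordinates sum to
      0.\<close>
    have Bx: "(\<Sum>j<n. ?B $$ (i, j) * x j) = y i" if i: "i < m" for i
    proof -
      define c where "c = (\<Sum>i<m. \<Sum>j<n. A $$ (i, j)) / of_nat (m * n)"
      have "(\<Sum>j<n. ?B $$ (i, j) * x j) = (\<Sum>j<n. A $$ (i, j) * x j - c * x j)"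
        using A i by (intro sum.cong) (auto simp: mean_mat_def c_def algebra_simps)
      also have "\<dots> = y i - c * (\<Sum>j<n. x j)"
        unfolding y_def by (simp add: sum_subtractf sum_distrib_left)
      finally show ?thesis unfolding x_sum by simp
    qed
    have "(\<Sum>i<m. \<Sum>j<n. z i * ?B $$ (i, j) * x j) = (\<Sum>i<m. z i * y i)"
      using Bx by (simp add: mult.assoc flip: sum_distrib_left)
    also have "\<dots> = (\<Sum>i<m. of_real ((cmod (y i))\<^sup>2 / r))"
      unfolding z_def by (intro sum.cong) (simp_all add: complex_norm_square mult.commute del: of_real_power)
    also have "\<dots> = of_real ((\<Sum>i<m. (cmod (y i))\<^sup>2) / r)"
      unfolding sum_divide_distrib of_real_sum ..
    also have "\<dots> = of_real r" unfolding r2 using r by (simp add: power2_eq_square)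
    finally have form: "s \<le> Re (\<Sum>i<m. \<Sum>j<n. z i * ?B $$ (i, j) * x j)" using r by simp
    note bound = bilinear_form_le_log[of "{..<m}" "{..<n}" "delta_norm ?B" "\<lambda>i j. ?B $$ (i, j)",
        OF _ _ D L2_set_subset_sum_le_delta_norm[OF B] _ _ z x s form,
        of "2 * mat_norm_1 A" "2 * mat_norm_inf A"]
    have K: "K = sqrt (2 * mat_norm_1 A * (2 * mat_norm_inf A)) / s"
    proof -
      have "sqrt (2 * mat_norm_1 A * (2 * mat_norm_inf A)) = sqrt (4 * (mat_norm_1 A * mat_norm_inf A))"
        by (simp add: mult_ac)
      also have "\<dots> = 2 * sqrt (mat_norm_1 A * mat_norm_inf A)"
        unfolding real_sqrt_mult by simp
      finally show ?thesis unfolding assms(3) s_def by simp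
    qed
    have le: "s \<le> 4 * delta_norm ?B * sqrt (ln K + 2)"
      unfolding K using minus_mean_sum_le[OF A] by (intro bound(1)) auto
    \<comment> \<open>The Schur test yields \<open>K \<ge> 1\<close>, so the root in the denominator
      is positive.\<close>
    have "2 * mat_norm_1 A * (2 * mat_norm_inf A) \<ge> s\<^sup>2"
      using minus_mean_sum_le[OF A] by (intro bound(2)) auto
    then have "K \<ge> 1" unfolding K using s real_le_rsqrt by auto
    then have "ln K \<ge> 0" by (rule ln_ge_zero)
    then have q: "sqrt (ln K + 2) > 0" by (simp add: add_nonneg_pos)
    \<comment> \<open>The constant 4 obtained in \<open>le\<close> is relaxed to
      \<open>8 * sqrt 2\<close>.\<close>
    have "4 * 1 \<le> 8 * sqrt (2::real)" by (intro mult_mono) auto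
    then have "4 * (delta_norm ?B * sqrt (ln K + 2)) \<le> 8 * sqrt 2 * (delta_norm ?B * sqrt (ln K + 2))"
      using D q by (intro mult_right_mono) auto
    then have "s \<le> delta_norm ?B * (8 * sqrt 2 * sqrt (ln K + 2))"
      using le by (simp add: mult_ac)
    then show ?thesis using q unfolding s_def[symmetric] by (subst divide_le_eq) auto
  qed
qed

end
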